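(* Let $U\subset\mathbb{C}$ be open, with coordinate $r=r_1+ir_2$, and let $X=(x_1,t_1,\phi_1):U\to\mathbb{R}^3$ and $Y=(x_2,t_2,\phi_2):U\to\mathbb{R}^3$ be minimal surfaces in isothermal coordinates $(r_1,r_2)$ that are harmonic conjugates of each other. Put $X^s=(x_1,\,i t_1,\,\phi_1)$ and $Y^s=(x_2,\,i t_2,\,\phi_2)$. Then for every $\theta\in\mathbb{R}$, $$S_\theta=\cos(\theta)\,X^s+\sin(\theta)\,Y^s$$ is a complex Born-Infeld soliton.
   Context: Minimal surface in isothermal coordinates: a smooth immersion $X:U\to\mathbb{R}^3$ with $X_{r_1}\cdot X_{r_1}=X_{r_2}\cdot X_{r_2}$, $X_{r_1}\cdot X_{r_2}=0$ and vanishing mean curvature (equivalently, under the first two conditions, each component of $X$ is harmonic in $(r_1,r_2)$). Harmonic conjugate: $X$ and $Y$ are harmonic conjugates if $X_{r_1}=Y_{r_2}$ and $X_{r_2}=-Y_{r_1}$ on $U$ (that is, $X+iY$ is holomorphic in $r$). Born-Infeld equation: $(1-\phi_t^2)\phi_{xx}+2\phi_x\phi_t\phi_{xt}-(1+\phi_x^2)\phi_{tt}=0$. Complex Born-Infeld soliton: the word "soliton" just means a solution of the Born-Infeld equation. A map $(x,\,i\tau,\,\phi)$ on $U$, with $x,\tau,\phi$ real-valued smooth functions, is called a complex Born-Infeld soliton (with imaginary time $t=i\tau$) if, near every point of $U$ at which $(r_1,r_2)\mapsto(x,\tau)$ is a local diffeomorphism, $\phi$ regarded as a function of $x$ and $t=i\tau$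 satisfies the Born-Infeld equation, where differentiation in the imaginary variable $t=i\tau$ means $\partial_t=-i\,\partial_\tau$. *)

theory Defs
  imports "HOL-Analysis.Analysis"
begin

section \<open>Smooth maps on open sets\<close>

definition dir_deriv ::
    "'a::euclidean_space \<Rightarrow> ('a \<Rightarrow> 'b::real_normed_vector) \<Rightarrow> 'a \<Rightarrow> 'b" where
  "dir_deriv v f p = frechet_derivative f (at p) v"

text \<open>
  Used on open sets only: the derivative at a point is taken in the whole space. Since the
  domain is finite-dimensional, directional derivatives suffice to express \<open>C\<^sup>k\<close> regularity.
\<close>

fun Ck_on :: "nat \<Rightarrow> 'a::euclidean_space set \<Rightarrow> ('a \<Rightarrow> 'b::real_normed_vector) \<Rightarrow> bool" where
  "Ck_on 0 S f \<longleftrightarrow> continuous_on S f"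
| "Ck_on (Suc k) S f \<longleftrightarrow>
     (\<forall>p\<in>S. f differentiable (at p)) \<and> (\<forall>v. Ck_on k S (dir_deriv v f))"

definition smooth_on :: "'a::euclidean_space set \<Rightarrow> ('a \<Rightarrow> 'b::real_normed_vector) \<Rightarrow> bool" where
  "smooth_on S f \<longleftrightarrow> (\<forall>k. Ck_on k S f)"

definition diffeo_onto_image ::
    "'a::euclidean_space set \<Rightarrow> ('a \<Rightarrow> 'b::euclidean_space) \<Rightarrow> bool" where
  "diffeo_onto_image V F \<longleftrightarrow>
     open V \<and> smooth_on V F \<and> inj_on F V \<and> open (F ` V) \<and> smooth_on (F ` V) (inv_into V F)"

section \<open>Minimal surfaces in isothermal coordinates\<close>

text \<open>The parameter domain lies in the complex plane, with coordinate \<open>r = r\<^sub>1 + \<i> r\<^sub>2\<close>.\<close>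

definition D1 :: "(complex \<Rightarrow> 'b::real_normed_vector) \<Rightarrow> complex \<Rightarrow> 'b" where
  "D1 = dir_deriv 1"

definition D2 :: "(complex \<Rightarrow> 'b::real_normed_vector) \<Rightarrow> complex \<Rightarrow> 'b" where
  "D2 = dir_deriv \<i>"

definition unit_normal :: "(complex \<Rightarrow> real^3) \<Rightarrow> complex \<Rightarrow> real^3" where
  "unit_normal X r = sgn (cross3 (D1 X r) (D2 X r))"

text \<open>
  The classical formula \<open>(e G - 2 f F + g E) / (2 (E G - F\<^sup>2))\<close> in terms of the coefficients
  \<open>E, F, G\<close> and \<open>e, f, g\<close> of the first and second fundamental forms.
\<close>

definition mean_curvature :: "(complex \<Rightarrow> real^3) \<Rightarrow> complex \<Rightarrow> real" where
  "mean_curvature X r =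
     (let E = D1 X r \<bullet> D1 X r;
          F = D1 X r \<bullet> D2 X r;
          G = D2 X r \<bullet> D2 X r;
          N = unit_normal X r;
          e = D1 (D1 X) r \<bullet> N;
          f = D2 (D1 X) r \<bullet> N;
          g = D2 (D2 X) r \<bullet> N
      in (e * G - 2 * f * F + g * E) / (2 * (E * G - F\<^sup>2)))"

definition smooth_immersion_on :: "complex set \<Rightarrow> (complex \<Rightarrow> real^3) \<Rightarrow> bool" where
  "smooth_immersion_on U X \<longleftrightarrow>
     smooth_on U X \<and> (\<forall>r\<in>U. inj (frechet_derivative X (at r)))"

definition isothermal_minimal_surface :: "complex set \<Rightarrow> (complex \<Rightarrow> real^3) \<Rightarrow> bool" where
  "isothermal_minimal_surface U X \<longleftrightarrow>
     smooth_immersion_on U X \<and>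
     (\<forall>r\<in>U. D1 X r \<bullet> D1 X r = D2 X r \<bullet> D2 X r \<and> D1 X r \<bullet> D2 X r = 0) \<and>
     (\<forall>r\<in>U. mean_curvature X r = 0)"

definition harmonic_conjugates ::
    "complex set \<Rightarrow> (complex \<Rightarrow> real^3) \<Rightarrow> (complex \<Rightarrow> real^3) \<Rightarrow> bool" where
  "harmonic_conjugates U X Y \<longleftrightarrow> (\<forall>r\<in>U. D1 X r = D2 Y r \<and> D2 X r = - D1 Y r)"

section \<open>Born-Infeld solitons with imaginary time\<close>

text \<open>
  The left-hand side of the Born-Infeld equation is parameterized by the operators
  \<open>Dx\<close> and \<open>Dt\<close> for differentiation in \<open>x\<close> and \<open>t\<close>, so that it can be read with a complex time
  variable.
\<close>

definition born_infeld_lhs ::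
    "(('p \<Rightarrow> complex) \<Rightarrow> 'p \<Rightarrow> complex) \<Rightarrow> (('p \<Rightarrow> complex) \<Rightarrow> 'p \<Rightarrow> complex) \<Rightarrow>
     ('p \<Rightarrow> complex) \<Rightarrow> 'p \<Rightarrow> complex" where
  "born_infeld_lhs Dx Dt \<phi> p =
     (1 - (Dt \<phi> p)\<^sup>2) * Dx (Dx \<phi>) p + 2 * Dx \<phi> p * Dt \<phi> p * Dt (Dx \<phi>) p
       - (1 + (Dx \<phi> p)\<^sup>2) * Dt (Dt \<phi>) p"

text \<open>
  A function of \<open>x\<close> and \<open>t = \<i> \<tau>\<close> is represented as a function of the real pair \<open>(x, \<tau>)\<close>.
\<close>

definition D_x :: "(real \<times> real \<Rightarrow> complex) \<Rightarrow> real \<times> real \<Rightarrow> complex" where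
  "D_x = dir_deriv (1, 0)"

definition D_tau :: "(real \<times> real \<Rightarrow> complex) \<Rightarrow> real \<times> real \<Rightarrow> complex" where
  "D_tau = dir_deriv (0, 1)"

definition D_imag_time :: "(real \<times> real \<Rightarrow> complex) \<Rightarrow> real \<times> real \<Rightarrow> complex" where
  "D_imag_time \<phi> p = - \<i> * D_tau \<phi> p"

definition imag_time_born_infeld_solution ::
    "(real \<times> real) set \<Rightarrow> (real \<times> real \<Rightarrow> complex) \<Rightarrow> bool" where
  "imag_time_born_infeld_solution W \<phi> \<longleftrightarrow>
     Ck_on 2 W \<phi> \<and> (\<forall>p\<in>W. born_infeld_lhs D_x D_imag_time \<phi> p = 0)"

definition imag_time :: "real^3 \<Rightarrow> complex^3" where
  "imag_time v = vector [of_real (v $ 1), \<i> * of_real (v $ 2), of_real (v $ 3)]"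

text \<open>
  A point of \<open>U\<close> is one at which \<open>(x, \<tau>)\<close> is a local diffeomorphism iff it lies in one of the
  sets \<open>V\<close> below; on \<open>V\<close>, the function \<open>\<phi>\<close> becomes a function of \<open>(x, \<tau>)\<close> by composition with
  the inverse of \<open>(x, \<tau>)\<close> on \<open>V\<close>. The functions \<open>x, \<tau>, \<phi>\<close> are determined by \<open>S\<close> on \<open>U\<close>.
\<close>

definition complex_born_infeld_soliton :: "complex set \<Rightarrow> (complex \<Rightarrow> complex^3) \<Rightarrow> bool" where
  "complex_born_infeld_soliton U S \<longleftrightarrow>
     (\<exists>x \<tau> \<phi> :: complex \<Rightarrow> real.
        smooth_on U x \<and> smooth_on U \<tau> \<and> smooth_on U \<phi> \<and>
        (\<forall>r\<in>U. S r = imag_time (vector [x r, \<tau> r, \<phi> r])) \<and>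
        (\<forall>V\<subseteq>U. diffeo_onto_image V (\<lambda>r. (x r, \<tau> r)) \<longrightarrow>
           imag_time_born_infeld_solution ((\<lambda>r. (x r, \<tau> r)) ` V)
             (\<lambda>p. of_real (\<phi> (inv_into V (\<lambda>r. (x r, \<tau> r)) p)))))"

end

theory Submission
  imports Defs "HOL-Complex_Analysis.Cauchy_Integral_Formula"
begin

text \<open>
  Replacing \<open>t\<close> by \<open>\<i> \<tau>\<close> turns the Born-Infeld equation into the minimal surface equation
  \<open>(1 + u\<^sub>\<tau>\<^sup>2) u\<^sub>x\<^sub>x - 2 u\<^sub>x u\<^sub>\<tau> u\<^sub>x\<^sub>\<tau> + (1 + u\<^sub>x\<^sup>2) u\<^sub>\<tau>\<^sub>\<tau> = 0\<close> for the graph of \<open>\<phi> = u(x, \<tau>)\<close>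
  (\<open>imag_time_born_infeld_of_real\<close>). Since \<open>imag_time\<close> is linear over the reals, \<open>S\<^sub>\<theta>\<close> is the image
  of the real map \<open>Z = cos \<theta> X + sin \<theta> Y\<close>, a member of the associate family of \<open>X\<close>, and the claim
  is that \<open>Z\<close> is again minimal wherever it is a graph over the \<open>(x, \<tau>)\<close>-plane.

  Put \<open>Z' = cos \<theta> Y - sin \<theta> X\<close>. Then \<open>Z + \<i> Z' = exp (- \<i> \<theta>) (X + \<i> Y)\<close> is holomorphic, because
  conjugacy of \<open>X\<close> and \<open>Y\<close> is the Cauchy-Riemann system. Hence \<open>Z\<close> is harmonic with symmetric mixed
  partials (\<open>conjugate_pair_harmonic\<close>). The map \<open>Z\<close> is also conformal: conformality of \<open>X\<close> says that
  the squares of the components of \<open>X\<^sub>1 - \<i> X\<^sub>2\<close> add up to 0, and passing to \<open>Z\<close> multiplies this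
  vector by \<open>exp (- \<i> \<theta>)\<close>.

  It remains to see that a conformal harmonic map is a minimal graph (\<open>conformal_harmonic_graph\<close>).
  Take the Laplacian of \<open>\<phi> = u(x, \<tau>)\<close>. Because \<open>x\<close>, \<open>\<tau>\<close> and \<open>\<phi>\<close> are harmonic, the terms with first
  derivatives of \<open>u\<close> drop out, leaving
  \<open>u\<^sub>x\<^sub>x |grad x|\<^sup>2 + 2 u\<^sub>x\<^sub>\<tau> (grad x \<bullet> grad \<tau>) + u\<^sub>\<tau>\<^sub>\<tau> |grad \<tau>|\<^sup>2 = 0\<close>. Conformality makes the three
  coefficients proportional to \<open>1 + u\<^sub>\<tau>\<^sup>2\<close>, \<open>- u\<^sub>x u\<^sub>\<tau>\<close> and \<open>1 + u\<^sub>x\<^sup>2\<close>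
  (\<open>conformal_graph_elimination\<close>), which is the minimal surface equation.
\<close>

section \<open>Directional derivatives and regularity classes\<close>

lemma dir_deriv_eqI: "(f has_derivative f') (at p) \<Longrightarrow> dir_deriv v f p = f' v"
  unfolding dir_deriv_def by (metis frechet_derivative_at)

lemma has_derivative_dir_deriv:
  "f differentiable (at p) \<Longrightarrow> (f has_derivative (\<lambda>v. dir_deriv v f p)) (at p)"
  unfolding dir_deriv_def by (simp add: frechet_derivative_works[symmetric])

text \<open>
  Both functions have the same Frechet derivatives at \<open>p\<close>, if any, so the underlying choice
  operator gives the same result even where neither function is differentiable.
\<close>

lemma dir_deriv_cong:
  assumes "open S" "p \<in> S" "\<And>q. q \<in> S \<Longrightarrow> f q = g q"
  shows "dir_deriv v f p = dir_deriv v g p"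
proof -
  have "(f has_derivative f') (at p) \<longleftrightarrow> (g has_derivative f') (at p)" for f'
    using assms by (metis has_derivative_transform_within_open)
  then show ?thesis
    unfolding dir_deriv_def frechet_derivative_def by simp
qed

lemma differentiable_cong_open:
  assumes "open S" "p \<in> S" "\<And>q. q \<in> S \<Longrightarrow> f q = g q" "f differentiable (at p)"
  shows "g differentiable (at p)"
  using assms unfolding differentiable_def by (metis has_derivative_transform_within_open)

lemma dir_deriv_bounded_linear:
  assumes "bounded_linear L" "f differentiable (at p)"
  shows "dir_deriv v (\<lambda>q. L (f q)) p = L (dir_deriv v f p)"
  by (rule dir_deriv_eqI)
    (rule bounded_linear.has_derivative[OF assms(1) has_derivative_dir_deriv[OF assms(2)]])

lemma dir_deriv_add:
  assumes "f differentiable (at p)" "g differentiable (at p)"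
  shows "dir_deriv v (\<lambda>q. f q + g q) p = dir_deriv v f p + dir_deriv v g p"
  by (rule dir_deriv_eqI) (intro has_derivative_add has_derivative_dir_deriv assms)

lemma dir_deriv_linear_combination:
  assumes "f differentiable (at p)" "g differentiable (at p)"
  shows "dir_deriv v (\<lambda>q. c *\<^sub>R f q + d *\<^sub>R g q) p = c *\<^sub>R dir_deriv v f p + d *\<^sub>R dir_deriv v g p"
  by (rule dir_deriv_eqI)
    (intro has_derivative_add has_derivative_scaleR_right has_derivative_dir_deriv assms)

lemma dir_deriv_scaleR:
  assumes "a differentiable (at p)" "f differentiable (at p)"
  shows "dir_deriv v (\<lambda>q. a q *\<^sub>R f q) p = a p *\<^sub>R dir_deriv v f p + dir_deriv v a p *\<^sub>R f p"
  by (rule dir_deriv_eqI) (intro has_derivative_scaleR has_derivative_dir_deriv assms)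

lemma dir_deriv_compose:
  fixes g :: "'a::euclidean_space \<Rightarrow> 'b::euclidean_space"
  assumes "g differentiable (at p)" "f differentiable (at (g p))"
  shows "dir_deriv v (\<lambda>q. f (g q)) p = (\<Sum>b\<in>Basis. (dir_deriv v g p \<bullet> b) *\<^sub>R dir_deriv b f (g p))"
proof -
  have lin: "linear (\<lambda>w. dir_deriv w f (g p))"
    using has_derivative_dir_deriv[OF assms(2)] has_derivative_linear by blast
  have "((\<lambda>q. f (g q)) has_derivative (\<lambda>v. dir_deriv (dir_deriv v g p) f (g p))) (at p)"
    by (rule has_derivative_compose[OF has_derivative_dir_deriv[OF assms(1)]
          has_derivative_dir_deriv[OF assms(2)]])
  then have "dir_deriv v (\<lambda>q. f (g q)) p = dir_deriv (dir_deriv v g p) f (g p)"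
    by (rule dir_deriv_eqI)
  also have "\<dots> = dir_deriv (\<Sum>b\<in>Basis. (dir_deriv v g p \<bullet> b) *\<^sub>R b) f (g p)"
    by (simp add: euclidean_representation)
  also have "\<dots> = (\<Sum>b\<in>Basis. (dir_deriv v g p \<bullet> b) *\<^sub>R dir_deriv b f (g p))"
    by (simp add: linear_sum[OF lin] linear_cmul[OF lin])
  finally show ?thesis .
qed

lemma Ck_on_cong:
  assumes "open S" "\<And>p. p \<in> S \<Longrightarrow> f p = g p" "Ck_on k S f"
  shows "Ck_on k S g"
  using assms(2,3)
proof (induction k arbitrary: f g)
  case 0
  then show ?case by (simp cong: continuous_on_cong)
next
  case (Suc k)
  have "dir_deriv v f p = dir_deriv v g p" if "p \<in> S" for v p
    using dir_deriv_cong[OF assms(1) that] Suc.prems(1) by blast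
  then have "Ck_on k S (dir_deriv v g)" for v
    using Suc.IH Suc.prems(2) by (metis Ck_on.simps(2))
  moreover have "g differentiable (at p)" if "p \<in> S" for p
    using differentiable_cong_open[OF assms(1) that] Suc.prems that by (metis Ck_on.simps(2))
  ultimately show ?case by simp
qed

lemma Ck_on_SucD: "Ck_on (Suc k) S f \<Longrightarrow> Ck_on k S f"
proof (induction k arbitrary: f)
  case 0
  then show ?case
    by (auto intro!: continuous_at_imp_continuous_on differentiable_imp_continuous_within)
next
  case (Suc k)
  then show ?case by (metis Ck_on.simps(2))
qed

lemma Ck_on_bounded_linear:
  assumes "bounded_linear L" "open S" "Ck_on k S f"
  shows "Ck_on k S (\<lambda>p. L (f p))"
  using assms(3)
proof (induction k arbitrary: f)
  case 0
  then show ?case using bounded_linear.continuous_on[OF assms(1)] by simp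
next
  case (Suc k)
  have "(\<lambda>q. L (f q)) differentiable (at p)" if "p \<in> S" for p
    using Suc.prems that bounded_linear.has_derivative[OF assms(1)]
    unfolding Ck_on.simps(2) differentiable_def by blast
  moreover have "Ck_on k S (dir_deriv v (\<lambda>q. L (f q)))" for v
  proof (rule Ck_on_cong[OF assms(2)])
    show "Ck_on k S (\<lambda>p. L (dir_deriv v f p))"
      using Suc by simp
    show "L (dir_deriv v f p) = dir_deriv v (\<lambda>q. L (f q)) p" if "p \<in> S" for p
      using Suc.prems that by (simp add: dir_deriv_bounded_linear[OF assms(1)])
  qed
  ultimately show ?case by simp
qed

lemma Ck_on_add:
  assumes "open S" "Ck_on k S f" "Ck_on k S g"
  shows "Ck_on k S (\<lambda>p. f p + g p)"
  using assms(2,3)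
proof (induction k arbitrary: f g)
  case 0
  then show ?case by (simp add: continuous_on_add)
next
  case (Suc k)
  have "Ck_on k S (dir_deriv v (\<lambda>p. f p + g p))" for v
  proof (rule Ck_on_cong[OF assms(1)])
    show "Ck_on k S (\<lambda>p. dir_deriv v f p + dir_deriv v g p)"
      using Suc by simp
    show "dir_deriv v f p + dir_deriv v g p = dir_deriv v (\<lambda>p. f p + g p) p" if "p \<in> S" for p
      using Suc.prems that by (intro dir_deriv_add[symmetric]) simp_all
  qed
  then show ?case using Suc.prems by simp
qed

lemma Ck_on_zero:
  "Ck_on k S (\<lambda>p. 0 :: 'b::real_normed_vector)" for S :: "'a::euclidean_space set"
proof (induction k)
  case (Suc k)
  moreover have "dir_deriv v (\<lambda>p. 0 :: 'b) = (\<lambda>p. 0)" for v :: 'a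
    by (simp add: dir_deriv_def fun_eq_iff)
  ultimately show ?case by simp
qed simp

lemma Ck_on_sum:
  assumes "open S" "finite I" "\<And>i. i \<in> I \<Longrightarrow> Ck_on k S (f i)"
  shows "Ck_on k S (\<lambda>p. \<Sum>i\<in>I. f i p)"
  using assms(2,3) by (induction I rule: finite_induct) (simp_all add: Ck_on_zero Ck_on_add assms(1))

lemma Ck_on_scaleR:
  assumes "open S" "Ck_on k S a" "Ck_on k S f"
  shows "Ck_on k S (\<lambda>p. a p *\<^sub>R f p)"
  using assms(2,3)
proof (induction k arbitrary: a f)
  case 0
  then show ?case by (simp add: continuous_on_scaleR)
next
  case (Suc k)
  have "Ck_on k S (dir_deriv v (\<lambda>p. a p *\<^sub>R f p))" for v
  proof (rule Ck_on_cong[OF assms(1)])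
    have "Ck_on k S a" "Ck_on k S f"
      using Suc.prems Ck_on_SucD by blast+
    then show "Ck_on k S (\<lambda>p. a p *\<^sub>R dir_deriv v f p + dir_deriv v a p *\<^sub>R f p)"
      using Suc by (intro Ck_on_add[OF assms(1)]) simp_all
    show "a p *\<^sub>R dir_deriv v f p + dir_deriv v a p *\<^sub>R f p = dir_deriv v (\<lambda>p. a p *\<^sub>R f p) p"
      if "p \<in> S" for p
      using Suc.prems that by (intro dir_deriv_scaleR[symmetric]) simp_all
  qed
  then show ?case using Suc.prems by simp
qed

text \<open>
  The chain rule writes a directional derivative of the composition as a sum of products of
  \<open>dir_deriv v g\<close> with derivatives of \<open>f\<close> composed with \<open>g\<close>; the latter are one order less regular
  than \<open>f\<close>, so the induction generalizes over \<open>f\<close>. Applied to \<open>\<phi>\<close> and the inverse of \<open>(x, \<tau>)\<close>, this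
  shows that \<open>\<phi>\<close> is a sufficiently regular function of \<open>(x, \<tau>)\<close>.
\<close>

lemma Ck_on_compose:
  fixes g :: "'a::euclidean_space \<Rightarrow> 'b::euclidean_space"
  assumes "open S" "g ` S \<subseteq> T" "Ck_on k S g" "Ck_on k T f"
  shows "Ck_on k S (\<lambda>p. f (g p))"
  using assms(3,4)
proof (induction k arbitrary: f)
  case 0
  then show ?case using assms(2) by (auto intro: continuous_on_compose2)
next
  case (Suc k)
  have diff: "g differentiable (at p)" "f differentiable (at (g p))" if "p \<in> S" for p
    using Suc.prems assms(2) that by auto
  have "Ck_on k S (dir_deriv v (\<lambda>p. f (g p)))" for v
  proof (rule Ck_on_cong[OF assms(1)])
    have "Ck_on k S (\<lambda>p. dir_deriv v g p \<bullet> b)" for b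
      using Suc.prems by (intro Ck_on_bounded_linear[OF bounded_linear_inner_left assms(1)]) simp
    moreover have "Ck_on k S (\<lambda>p. dir_deriv b f (g p))" for b
      by (rule Suc.IH[OF Ck_on_SucD[OF Suc.prems(1)]]) (use Suc.prems(2) in simp)
    ultimately show
      "Ck_on k S (\<lambda>p. \<Sum>b\<in>Basis. (dir_deriv v g p \<bullet> b) *\<^sub>R dir_deriv b f (g p))"
      by (intro Ck_on_sum Ck_on_scaleR assms(1) finite_Basis)
    show "(\<Sum>b\<in>Basis. (dir_deriv v g p \<bullet> b) *\<^sub>R dir_deriv b f (g p))
        = dir_deriv v (\<lambda>p. f (g p)) p" if "p \<in> S" for p
      using dir_deriv_compose[OF diff[OF that]] by simp
  qed
  moreover have "(\<lambda>p. f (g p)) differentiable (at p)" if "p \<in> S" for p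
    using differentiable_chain_at[OF diff[OF that]] by (simp add: o_def)
  ultimately show ?case by simp
qed

lemma C2_on_differentiable:
  assumes "Ck_on 2 S f" "p \<in> S"
  shows "f differentiable (at p)" "dir_deriv v f differentiable (at p)"
  using assms unfolding numeral_2_eq_2 Ck_on.simps(2) by simp_all

lemma smooth_on_differentiable:
  assumes "smooth_on S f" "p \<in> S"
  shows "f differentiable (at p)" "dir_deriv v f differentiable (at p)"
  using C2_on_differentiable assms unfolding smooth_on_def by blast+

lemma smooth_on_bounded_linear:
  "bounded_linear L \<Longrightarrow> open S \<Longrightarrow> smooth_on S f \<Longrightarrow> smooth_on S (\<lambda>p. L (f p))"
  unfolding smooth_on_def by (iprover intro: Ck_on_bounded_linear)

lemma smooth_on_linear_combination:
  assumes "open S" "smooth_on S f" "smooth_on S g"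
  shows "smooth_on S (\<lambda>p. c *\<^sub>R f p + d *\<^sub>R g p)"
  using assms unfolding smooth_on_def
  by (intro allI Ck_on_add[OF assms(1)] Ck_on_bounded_linear[OF bounded_linear_scaleR_right assms(1)]) simp_all

lemma smooth_on_mono: "smooth_on T f \<Longrightarrow> S \<subseteq> T \<Longrightarrow> smooth_on S f"
proof -
  have "Ck_on k T f \<Longrightarrow> S \<subseteq> T \<Longrightarrow> Ck_on k S f" for k
    by (induction k arbitrary: f) (auto intro: continuous_on_subset)
  then show "smooth_on T f \<Longrightarrow> S \<subseteq> T \<Longrightarrow> smooth_on S f"
    by (simp add: smooth_on_def)
qed

section \<open>Harmonicity of conjugate functions\<close>

text \<open>
  The pair \<open>Re h\<close>, \<open>- Im h\<close> is chosen because a harmonic \<open>a\<close> is the real part of some holomorphic \<open>H\<close>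
  locally, and then its partials are \<open>Re H'\<close> and \<open>- Im H'\<close>.
\<close>

lemma partials_of_holomorphic:
  assumes "(h has_field_derivative h') (at z)"
  shows "D1 (\<lambda>w. Re (h w)) z = Re h'" "D2 (\<lambda>w. Re (h w)) z = - Im h'"
    "D1 (\<lambda>w. - Im (h w)) z = - Im h'" "D2 (\<lambda>w. - Im (h w)) z = - Re h'"
proof -
  have "((\<lambda>w. Re (h w)) has_derivative (\<lambda>v. Re (h' * v))) (at z)"
    "((\<lambda>w. - Im (h w)) has_derivative (\<lambda>v. - Im (h' * v))) (at z)"
    using assms unfolding has_field_derivative_def
    by (intro derivative_intros; simp)+
  then show "D1 (\<lambda>w. Re (h w)) z = Re h'" "D2 (\<lambda>w. Re (h w)) z = - Im h'"
    "D1 (\<lambda>w. - Im (h w)) z = - Im h'" "D2 (\<lambda>w. - Im (h w)) z = - Re h'"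
    unfolding D1_def D2_def by (simp_all add: dir_deriv_eqI)
qed

lemma dir_deriv_complex_expansion:
  assumes "f differentiable (at z)"
  shows "dir_deriv v f z = Re v *\<^sub>R D1 f z + Im v *\<^sub>R D2 f z"
proof -
  have lin: "linear (\<lambda>w. dir_deriv w f z)"
    using has_derivative_dir_deriv[OF assms] has_derivative_linear by blast
  have "v = Re v *\<^sub>R 1 + Im v *\<^sub>R \<i>"
    by (simp add: complex_eq_iff)
  then show ?thesis
    using linear_add[OF lin] linear_cmul[OF lin] unfolding D1_def D2_def by metis
qed

text \<open>
  The Cauchy-Riemann equations make \<open>h = a + \<i> b\<close> holomorphic. Its derivative \<open>D1 a - \<i> D2 a\<close> is then
  holomorphic as well, and the two conclusions are the Cauchy-Riemann equations for this
  derivative.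
\<close>

lemma conjugate_pair_harmonic:
  fixes a b :: "complex \<Rightarrow> real"
  assumes "open U" and diff: "\<And>r. r \<in> U \<Longrightarrow> a differentiable (at r)"
      "\<And>r. r \<in> U \<Longrightarrow> b differentiable (at r)"
    and CR: "\<And>r. r \<in> U \<Longrightarrow> D1 a r = D2 b r" "\<And>r. r \<in> U \<Longrightarrow> D2 a r = - D1 b r"
    and "r \<in> U"
  shows "D1 (D1 a) r + D2 (D2 a) r = 0" "D1 (D2 a) r = D2 (D1 a) r"
proof -
  define h where "h = (\<lambda>z. Complex (a z) (b z))"
  have der: "(h has_field_derivative Complex (D1 a z) (D1 b z)) (at z)" if "z \<in> U" for z
  proof -
    have "((\<lambda>z. complex_of_real (a z) + \<i> * complex_of_real (b z)) has_derivative
        (\<lambda>v. complex_of_real (dir_deriv v a z) + \<i> * complex_of_real (dir_deriv v b z))) (at z)"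
      by (intro derivative_intros has_derivative_dir_deriv diff that)
    moreover have "complex_of_real (dir_deriv v a z) + \<i> * complex_of_real (dir_deriv v b z)
        = Complex (D1 a z) (D1 b z) * v" for v
      using CR[OF that] diff[OF that]
      by (simp add: dir_deriv_complex_expansion complex_eq_iff algebra_simps)
    ultimately show ?thesis
      by (simp add: has_field_derivative_def h_def Complex_eq)
  qed
  then have holo: "h holomorphic_on U"
    using \<open>open U\<close> by (auto simp: holomorphic_on_open)
  have "(deriv h has_field_derivative deriv (deriv h) z) (at z)" if "z \<in> U" for z
    using holomorphic_derivI[OF holomorphic_deriv[OF holo \<open>open U\<close>] \<open>open U\<close> that] .
  note der2 = partials_of_holomorphic[OF this[OF \<open>r \<in> U\<close>]]
  have "deriv h z = Complex (D1 a z) (D1 b z)" if "z \<in> U" for z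
    using der[OF that] by (rule DERIV_imp_deriv)
  then have *: "D1 a z = Re (deriv h z)" "D2 a z = - Im (deriv h z)" if "z \<in> U" for z
    using CR that by auto
  have "D1 (D1 a) r = Re (deriv (deriv h) r)" "D2 (D1 a) r = - Im (deriv (deriv h) r)"
    "D1 (D2 a) r = - Im (deriv (deriv h) r)" "D2 (D2 a) r = - Re (deriv (deriv h) r)"
    using der2 dir_deriv_cong[OF \<open>open U\<close> \<open>r \<in> U\<close>, of "D1 a" "\<lambda>z. Re (deriv h z)"]
      dir_deriv_cong[OF \<open>open U\<close> \<open>r \<in> U\<close>, of "D2 a" "\<lambda>z. - Im (deriv h z)"] *
    unfolding D1_def D2_def by simp_all
  then show "D1 (D1 a) r + D2 (D2 a) r = 0" "D1 (D2 a) r = D2 (D1 a) r"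
    by simp_all
qed

section \<open>Conformal harmonic maps as graphs\<close>

lemma dir_deriv_compose_pair:
  fixes w :: "real \<times> real \<Rightarrow> real" and x \<tau> :: "complex \<Rightarrow> real"
  assumes "x differentiable (at r)" "\<tau> differentiable (at r)" "w differentiable (at (x r, \<tau> r))"
  shows "dir_deriv v (\<lambda>r. w (x r, \<tau> r)) r =
    dir_deriv (1, 0) w (x r, \<tau> r) * dir_deriv v x r + dir_deriv (0, 1) w (x r, \<tau> r) * dir_deriv v \<tau> r"
proof -
  have F: "((\<lambda>r. (x r, \<tau> r)) has_derivative (\<lambda>v. (dir_deriv v x r, dir_deriv v \<tau> r))) (at r)"
    by (intro has_derivative_Pair has_derivative_dir_deriv assms)
  then have "(\<lambda>r. (x r, \<tau> r)) differentiable (at r)"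
    by (rule differentiableI)
  from dir_deriv_compose[OF this assms(3), of v] show ?thesis
    by (simp add: dir_deriv_eqI[OF F] Basis_prod_def sum.union_disjoint image_iff mult.commute)
qed

text \<open>
  Second derivatives of \<open>\<phi> = u(x, \<tau>)\<close>. The two mixed derivatives of \<open>u\<close> are kept apart: that they
  agree is deduced later, from this very formula.
\<close>

lemma dir_deriv2_compose_pair:
  fixes u :: "real \<times> real \<Rightarrow> real" and x \<tau> \<phi> :: "complex \<Rightarrow> real"
  assumes "open V" "r \<in> V" "smooth_on V x" "smooth_on V \<tau>"
    "Ck_on 2 ((\<lambda>r. (x r, \<tau> r)) ` V) u" "\<And>r. r \<in> V \<Longrightarrow> \<phi> r = u (x r, \<tau> r)"
  defines "F \<equiv> (\<lambda>r. (x r, \<tau> r))" and "Dx \<equiv> dir_deriv (1, 0)" and "D\<tau> \<equiv> dir_deriv (0, 1)"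
  shows "dir_deriv w (dir_deriv v \<phi>) r =
      (Dx (Dx u) (F r) * dir_deriv w x r + D\<tau> (Dx u) (F r) * dir_deriv w \<tau> r) * dir_deriv v x r
    + (Dx (D\<tau> u) (F r) * dir_deriv w x r + D\<tau> (D\<tau> u) (F r) * dir_deriv w \<tau> r) * dir_deriv v \<tau> r
    + Dx u (F r) * dir_deriv w (dir_deriv v x) r + D\<tau> u (F r) * dir_deriv w (dir_deriv v \<tau>) r"
proof -
  have u: "u differentiable (at (F r))" "dir_deriv e u differentiable (at (F r))"
    if "r \<in> V" for r e
    using C2_on_differentiable[OF assms(5)] that by (simp_all add: F_def)
  note diff = smooth_on_differentiable[OF assms(3)] smooth_on_differentiable[OF assms(4)]
  have F: "F differentiable (at r)"
    unfolding F_def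
    by (rule differentiableI[OF has_derivative_Pair[OF has_derivative_dir_deriv[OF diff(1)]
            has_derivative_dir_deriv[OF diff(3)]]]) (rule assms(2))+
  have uF: "(\<lambda>r. dir_deriv e u (F r)) differentiable (at r)" for e
    using differentiable_chain_at[OF F u(2)[OF assms(2)]] by (simp add: o_def)
  have first: "dir_deriv v \<phi> s = dir_deriv v x s *\<^sub>R Dx u (F s) + dir_deriv v \<tau> s *\<^sub>R D\<tau> u (F s)"
    if "s \<in> V" for s
  proof -
    have "dir_deriv v \<phi> s = dir_deriv v (\<lambda>r. u (x r, \<tau> r)) s"
      using assms(6) by (rule dir_deriv_cong[OF assms(1) that])
    also have "\<dots> = Dx u (F s) * dir_deriv v x s + D\<tau> u (F s) * dir_deriv v \<tau> s"
      using u(1)[OF that] unfolding F_def Dx_def D\<tau>_def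
      by (intro dir_deriv_compose_pair diff that)
    finally show ?thesis by (simp only: real_scaleR_def mult.commute)
  qed
  have second: "dir_deriv w (\<lambda>r. dir_deriv e u (F r)) r
      = Dx (dir_deriv e u) (F r) * dir_deriv w x r + D\<tau> (dir_deriv e u) (F r) * dir_deriv w \<tau> r" for e
    using u(2)[OF assms(2)] unfolding F_def Dx_def D\<tau>_def
    by (intro dir_deriv_compose_pair diff assms(2))
  have "dir_deriv w (dir_deriv v \<phi>) r
      = dir_deriv w (\<lambda>s. dir_deriv v x s *\<^sub>R Dx u (F s) + dir_deriv v \<tau> s *\<^sub>R D\<tau> u (F s)) r"
    using first by (rule dir_deriv_cong[OF assms(1,2)])
  also have "\<dots> = dir_deriv w (\<lambda>s. dir_deriv v x s *\<^sub>R Dx u (F s)) r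
      + dir_deriv w (\<lambda>s. dir_deriv v \<tau> s *\<^sub>R D\<tau> u (F s)) r"
    unfolding Dx_def D\<tau>_def
    by (intro dir_deriv_add differentiable_scaleR diff uF assms(2))
  also have "dir_deriv w (\<lambda>s. dir_deriv v x s *\<^sub>R Dx u (F s)) r
      = dir_deriv v x r *\<^sub>R dir_deriv w (\<lambda>s. Dx u (F s)) r + dir_deriv w (dir_deriv v x) r *\<^sub>R Dx u (F r)"
    unfolding Dx_def by (intro dir_deriv_scaleR diff uF assms(2))
  also have "dir_deriv w (\<lambda>s. dir_deriv v \<tau> s *\<^sub>R D\<tau> u (F s)) r
      = dir_deriv v \<tau> r *\<^sub>R dir_deriv w (\<lambda>s. D\<tau> u (F s)) r + dir_deriv w (dir_deriv v \<tau>) r *\<^sub>R D\<tau> u (F r)"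
    unfolding D\<tau>_def by (intro dir_deriv_scaleR diff uF assms(2))
  also have "dir_deriv w (\<lambda>s. Dx u (F s)) r
      = Dx (Dx u) (F r) * dir_deriv w x r + D\<tau> (Dx u) (F r) * dir_deriv w \<tau> r"
    using second[of "(1, 0)"] by (simp only: Dx_def)
  also have "dir_deriv w (\<lambda>s. D\<tau> u (F s)) r
      = Dx (D\<tau> u) (F r) * dir_deriv w x r + D\<tau> (D\<tau> u) (F r) * dir_deriv w \<tau> r"
    using second[of "(0, 1)"] by (simp only: D\<tau>_def)
  finally show ?thesis by (simp add: algebra_simps)
qed

text \<open>
  Write \<open>J\<close> for the matrix with rows \<open>(x1, x2)\<close> and \<open>(t1, t2)\<close>, and \<open>M\<close> for the metric of the graph,
  with rows \<open>(1 + p\<^sup>2, p q)\<close> and \<open>(p q, 1 + q\<^sup>2)\<close>. Conformality says \<open>J\<^sup>T M J = E I\<close>. Hence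
  \<open>(J J\<^sup>T M - E I) J = 0\<close>, and since \<open>J\<close> is invertible, \<open>J J\<^sup>T = E M\<^sup>-\<^sup>1\<close>. So the coefficients of \<open>a\<close>,
  \<open>b\<close> and \<open>c\<close> in the trace equation, which are the entries of \<open>J J\<^sup>T\<close> with the off-diagonal
  one doubled, are up to a positive factor those of the adjugate of \<open>M\<close>.
\<close>

lemma conformal_graph_elimination:
  fixes x1 x2 t1 t2 p q a b c :: real
  defines "f1 \<equiv> p * x1 + q * t1" and "f2 \<equiv> p * x2 + q * t2"
  assumes "x1 * t2 - x2 * t1 \<noteq> 0"
    and eq: "x1\<^sup>2 + t1\<^sup>2 + f1\<^sup>2 = x2\<^sup>2 + t2\<^sup>2 + f2\<^sup>2"
    and orth: "x1 * x2 + t1 * t2 + f1 * f2 = 0"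
    and trace: "a * (x1\<^sup>2 + x2\<^sup>2) + 2 * b * (x1 * t1 + x2 * t2) + c * (t1\<^sup>2 + t2\<^sup>2) = 0"
  shows "(1 + q\<^sup>2) * a - 2 * p * q * b + (1 + p\<^sup>2) * c = 0"
proof -
  define A B C where "A = x1\<^sup>2 + x2\<^sup>2" "B = x1 * t1 + x2 * t2" "C = t1\<^sup>2 + t2\<^sup>2"
  define E where "E = x1\<^sup>2 + t1\<^sup>2 + f1\<^sup>2"
  have "E > 0"
    using assms(3) unfolding E_def
    by (metis add_nonneg_nonneg add_pos_nonneg diff_self mult_zero_left mult_zero_right
        add_nonneg_pos zero_le_power2 zero_less_power2)
  \<comment> \<open>A row vector annihilated by \<open>J\<close> vanishes; it is applied to both rows of \<open>J J\<^sup>T M - E I\<close>.\<close>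
  have cancel: "y = 0 \<and> z = 0" if "y * x1 + z * t1 = 0" "y * x2 + z * t2 = 0" for y z :: real
  proof -
    have "y * (x1 * t2 - x2 * t1) = 0" "z * (x1 * t2 - x2 * t1) = 0"
      using that by algebra+
    then show ?thesis using assms(3) by simp
  qed
  have "A * (1 + p\<^sup>2) + B * (p * q) - E = 0 \<and> A * (p * q) + B * (1 + q\<^sup>2) = 0"
    by (rule cancel) (use eq orth in \<open>unfold A_B_C_def E_def f1_def f2_def, algebra+\<close>)
  moreover have "B * (1 + p\<^sup>2) + C * (p * q) = 0 \<and> B * (p * q) + C * (1 + q\<^sup>2) - E = 0"
    by (rule cancel) (use eq orth in \<open>unfold A_B_C_def E_def f1_def f2_def, algebra+\<close>)
  \<comment> \<open>Cramer's rule, with \<open>det M = 1 + p\<^sup>2 + q\<^sup>2\<close>.\<close>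
  ultimately have "A * (1 + p\<^sup>2 + q\<^sup>2) = E * (1 + q\<^sup>2)"
    "B * (1 + p\<^sup>2 + q\<^sup>2) = - E * (p * q)" "C * (1 + p\<^sup>2 + q\<^sup>2) = E * (1 + p\<^sup>2)"
    by algebra+
  moreover have "a * A + 2 * b * B + c * C = 0"
    using trace by (simp add: A_B_C_def)
  ultimately have "E * ((1 + q\<^sup>2) * a - 2 * p * q * b + (1 + p\<^sup>2) * c) = 0"
    by algebra
  then show ?thesis using \<open>E > 0\<close> by simp
qed

text \<open>
  Differentiating \<open>G (F s) = s\<close> for the inverse \<open>G\<close> of \<open>F = (x, \<tau>)\<close> exhibits a left inverse of the
  Jacobian matrix of \<open>F\<close>. Here \<open>G\<close> is split into real and imaginary parts so that the chain rule
  for real functions of \<open>(x, \<tau>)\<close> applies.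
\<close>

lemma diffeo_onto_image_jacobian_nonzero:
  fixes x \<tau> :: "complex \<Rightarrow> real"
  assumes "diffeo_onto_image V (\<lambda>r. (x r, \<tau> r))" "smooth_on V x" "smooth_on V \<tau>" "r \<in> V"
  shows "D1 x r * D2 \<tau> r - D2 x r * D1 \<tau> r \<noteq> 0"
proof -
  define F where "F = (\<lambda>r. (x r, \<tau> r))"
  define G where "G = inv_into V F"
  have V: "open V" "inj_on F V" "smooth_on (F ` V) G"
    using assms(1) by (auto simp: diffeo_onto_image_def F_def G_def)
  have G: "G differentiable (at (F r))"
    using smooth_on_differentiable(1)[OF V(3)] assms(4) by simp
  have Re: "(\<lambda>p. Re (G p)) differentiable (at (F r))" and Im: "(\<lambda>p. Im (G p)) differentiable (at (F r))"
    using G unfolding differentiable_def by (blast intro: derivative_intros)+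
  have inv: "G (F s) = s" if "s \<in> V" for s
    using V(2) that by (simp add: G_def)
  note diff = smooth_on_differentiable(1)[OF assms(2,4)] smooth_on_differentiable(1)[OF assms(3,4)]
  have "dir_deriv v (\<lambda>s. Re (G (x s, \<tau> s))) r = Re v" "dir_deriv v (\<lambda>s. Im (G (x s, \<tau> s))) r = Im v"
    for v
  proof -
    have "dir_deriv v (\<lambda>s. Re (G (x s, \<tau> s))) r = dir_deriv v Re r"
      "dir_deriv v (\<lambda>s. Im (G (x s, \<tau> s))) r = dir_deriv v Im r"
      using inv by (auto intro!: dir_deriv_cong[OF V(1) assms(4)] simp: F_def)
    moreover have "dir_deriv v Re r = Re v" "dir_deriv v Im r = Im v"
      by (auto intro!: dir_deriv_eqI derivative_eq_intros)
    ultimately show "dir_deriv v (\<lambda>s. Re (G (x s, \<tau> s))) r = Re v"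
      "dir_deriv v (\<lambda>s. Im (G (x s, \<tau> s))) r = Im v" by simp_all
  qed
  then have "dir_deriv (1, 0) (\<lambda>p. Re (G p)) (F r) * dir_deriv v x r
      + dir_deriv (0, 1) (\<lambda>p. Re (G p)) (F r) * dir_deriv v \<tau> r = Re v"
    "dir_deriv (1, 0) (\<lambda>p. Im (G p)) (F r) * dir_deriv v x r
      + dir_deriv (0, 1) (\<lambda>p. Im (G p)) (F r) * dir_deriv v \<tau> r = Im v" for v
    using dir_deriv_compose_pair[OF diff, of "\<lambda>p. Re (G p)" v] Re
      dir_deriv_compose_pair[OF diff, of "\<lambda>p. Im (G p)" v] Im
    by (simp_all add: F_def)
  from this[of 1] this[of \<i>] show ?thesis
    unfolding D1_def D2_def by simp algebra
qed

text \<open>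
  Each \<open>D_imag_time\<close> contributes a factor \<open>- \<i>\<close>, and time derivatives occur in pairs in every term
  that contains them. The resulting factors \<open>-1\<close> turn the Born-Infeld equation into the minimal
  surface equation.
\<close>

lemma imag_time_born_infeld_of_real:
  fixes u :: "real \<times> real \<Rightarrow> real"
  assumes "open W" "Ck_on 2 W u"
    and eq: "\<And>p. p \<in> W \<Longrightarrow>
      (1 + (dir_deriv (0, 1) u p)\<^sup>2) * dir_deriv (1, 0) (dir_deriv (1, 0) u) p
      - 2 * dir_deriv (1, 0) u p * dir_deriv (0, 1) u p * dir_deriv (0, 1) (dir_deriv (1, 0) u) p
      + (1 + (dir_deriv (1, 0) u p)\<^sup>2) * dir_deriv (0, 1) (dir_deriv (0, 1) u) p = 0"
  shows "imag_time_born_infeld_solution W (\<lambda>p. complex_of_real (u p))"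
  unfolding imag_time_born_infeld_solution_def
proof (intro conjI ballI)
  show "Ck_on 2 W (\<lambda>p. complex_of_real (u p))"
    by (rule Ck_on_bounded_linear[OF bounded_linear_of_real assms(1,2)])
  fix p assume p: "p \<in> W"
  have diff: "u differentiable (at p)" "dir_deriv e u differentiable (at p)" if "p \<in> W" for p e
    using C2_on_differentiable[OF assms(2)] that by blast+
  have lin: "bounded_linear (\<lambda>y. - \<i> * complex_of_real y)"
    by (intro bounded_linear_const_mult bounded_linear_of_real)
  have d1: "dir_deriv e (\<lambda>p. complex_of_real (u p)) q = of_real (dir_deriv e u q)" if "q \<in> W" for e q
    using dir_deriv_bounded_linear[OF bounded_linear_of_real diff(1)[OF that]] .
  have x: "D_x (\<lambda>p. complex_of_real (u p)) q = of_real (dir_deriv (1, 0) u q)"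
    and t: "D_imag_time (\<lambda>p. complex_of_real (u p)) q = - \<i> * of_real (dir_deriv (0, 1) u q)"
    if "q \<in> W" for q
    using d1[OF that] by (simp_all add: D_x_def D_imag_time_def D_tau_def)
  have dx: "dir_deriv e (D_x (\<lambda>p. complex_of_real (u p))) p
      = of_real (dir_deriv e (dir_deriv (1, 0) u) p)" for e
    using dir_deriv_cong[OF assms(1) p x]
      dir_deriv_bounded_linear[OF bounded_linear_of_real diff(2)[OF p]] by simp
  have dt: "dir_deriv e (D_imag_time (\<lambda>p. complex_of_real (u p))) p
      = - \<i> * of_real (dir_deriv e (dir_deriv (0, 1) u) p)" for e
    using dir_deriv_cong[OF assms(1) p t]
      dir_deriv_bounded_linear[OF lin diff(2)[OF p]] by simp
  have xx: "D_x (D_x (\<lambda>p. complex_of_real (u p))) p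
      = of_real (dir_deriv (1, 0) (dir_deriv (1, 0) u) p)"
    using dx[of "(1, 0)"] by (simp add: D_x_def)
  have tx: "D_imag_time (D_x (\<lambda>p. complex_of_real (u p))) p
      = - \<i> * of_real (dir_deriv (0, 1) (dir_deriv (1, 0) u) p)"
    unfolding D_imag_time_def D_tau_def dx ..
  have tt: "D_imag_time (D_imag_time (\<lambda>p. complex_of_real (u p))) p
      = - of_real (dir_deriv (0, 1) (dir_deriv (0, 1) u) p)"
    using dt[of "(0, 1)"] by (simp add: D_imag_time_def D_tau_def)
  have "born_infeld_lhs D_x D_imag_time (\<lambda>p. of_real (u p)) p = of_real (
      (1 + (dir_deriv (0, 1) u p)\<^sup>2) * dir_deriv (1, 0) (dir_deriv (1, 0) u) p
      - 2 * dir_deriv (1, 0) u p * dir_deriv (0, 1) u p * dir_deriv (0, 1) (dir_deriv (1, 0) u) p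
      + (1 + (dir_deriv (1, 0) u p)\<^sup>2) * dir_deriv (0, 1) (dir_deriv (0, 1) u) p)"
    unfolding born_infeld_lhs_def xx tx tt x[OF p] t[OF p]
    by (simp add: power2_eq_square algebra_simps)
  then show "born_infeld_lhs D_x D_imag_time (\<lambda>p. of_real (u p)) p = 0"
    using eq[OF p] by simp
qed

text \<open>
  The assumptions on second derivatives enter through \<open>dir_deriv2_compose_pair\<close>: symmetry in
  \<open>(r\<^sub>1, r\<^sub>2)\<close> makes the mixed derivatives of \<open>u\<close> agree, and harmonicity yields the trace equation that
  \<open>conformal_graph_elimination\<close> turns into the minimal surface equation.
\<close>

lemma conformal_harmonic_graph:
  fixes x \<tau> \<phi> :: "complex \<Rightarrow> real"
  assumes diffeo: "diffeo_onto_image V (\<lambda>r. (x r, \<tau> r))"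
    and smooth: "smooth_on V x" "smooth_on V \<tau>" "smooth_on V \<phi>"
    and harm: "\<And>f r. f \<in> {x, \<tau>, \<phi>} \<Longrightarrow> r \<in> V \<Longrightarrow> D1 (D1 f) r + D2 (D2 f) r = 0"
    and symm: "\<And>f r. f \<in> {x, \<tau>, \<phi>} \<Longrightarrow> r \<in> V \<Longrightarrow> D1 (D2 f) r = D2 (D1 f) r"
    and conf: "\<And>r. r \<in> V \<Longrightarrow> (D1 x r)\<^sup>2 + (D1 \<tau> r)\<^sup>2 + (D1 \<phi> r)\<^sup>2 = (D2 x r)\<^sup>2 + (D2 \<tau> r)\<^sup>2 + (D2 \<phi> r)\<^sup>2"
    and orth: "\<And>r. r \<in> V \<Longrightarrow> D1 x r * D2 x r + D1 \<tau> r * D2 \<tau> r + D1 \<phi> r * D2 \<phi> r = 0"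
  shows "imag_time_born_infeld_solution ((\<lambda>r. (x r, \<tau> r)) ` V)
    (\<lambda>p. of_real (\<phi> (inv_into V (\<lambda>r. (x r, \<tau> r)) p)))"
proof -
  define F where "F = (\<lambda>r. (x r, \<tau> r))"
  define u where "u = (\<lambda>p. \<phi> (inv_into V F p))"
  have V: "open V" "inj_on F V" "open (F ` V)" "smooth_on (F ` V) (inv_into V F)"
    using diffeo by (auto simp: diffeo_onto_image_def F_def)
  have u2: "Ck_on 2 (F ` V) u"
    unfolding u_def
    by (rule Ck_on_compose[OF V(3), where T = V])
      (use V(4) smooth(3) in \<open>auto simp: smooth_on_def inv_into_into\<close>)
  have \<phi>: "\<phi> s = u (x s, \<tau> s)" if "s \<in> V" for s
    using inv_into_f_f[OF V(2) that] by (simp add: u_def F_def)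
  have "imag_time_born_infeld_solution (F ` V) (\<lambda>p. complex_of_real (u p))"
  proof (rule imag_time_born_infeld_of_real[OF V(3) u2])
    fix p assume "p \<in> F ` V"
    then obtain r where r: "r \<in> V" "p = F r" by blast
    define P Q where "P = dir_deriv (1, 0) u p" and "Q = dir_deriv (0, 1) u p"
    define a b b' c where "a = dir_deriv (1, 0) (dir_deriv (1, 0) u) p"
      and "b = dir_deriv (0, 1) (dir_deriv (1, 0) u) p"
      and "b' = dir_deriv (1, 0) (dir_deriv (0, 1) u) p"
      and "c = dir_deriv (0, 1) (dir_deriv (0, 1) u) p"
    have diff: "x differentiable (at r)" "\<tau> differentiable (at r)" "u differentiable (at (x r, \<tau> r))"
      using smooth_on_differentiable(1)[OF smooth(1)] smooth_on_differentiable(1)[OF smooth(2)]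
        C2_on_differentiable(1)[OF u2] r by (simp_all add: F_def)
    have "dir_deriv v \<phi> r = P * dir_deriv v x r + Q * dir_deriv v \<tau> r" for v
      using dir_deriv_cong[OF V(1) r(1) \<phi>] dir_deriv_compose_pair[OF diff]
      by (simp add: P_def Q_def r(2) F_def)
    then have first: "D1 \<phi> r = P * D1 x r + Q * D1 \<tau> r" "D2 \<phi> r = P * D2 x r + Q * D2 \<tau> r"
      by (simp_all add: D1_def D2_def)
    have second: "dir_deriv w (dir_deriv v \<phi>) r =
        (a * dir_deriv w x r + b * dir_deriv w \<tau> r) * dir_deriv v x r
      + (b' * dir_deriv w x r + c * dir_deriv w \<tau> r) * dir_deriv v \<tau> r
      + P * dir_deriv w (dir_deriv v x) r + Q * dir_deriv w (dir_deriv v \<tau>) r" for v w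
      using dir_deriv2_compose_pair[OF V(1) r(1) smooth(1,2) u2[unfolded F_def] \<phi>]
      by (simp add: a_def b_def b'_def c_def P_def Q_def r(2) F_def)
    have det: "D1 x r * D2 \<tau> r - D2 x r * D1 \<tau> r \<noteq> 0"
      by (rule diffeo_onto_image_jacobian_nonzero[OF diffeo smooth(1,2) r(1)])
    have sy: "D1 (D2 x) r = D2 (D1 x) r" "D1 (D2 \<tau>) r = D2 (D1 \<tau>) r" "D1 (D2 \<phi>) r = D2 (D1 \<phi>) r"
      using symm r(1) by simp_all
    have ha: "D1 (D1 x) r + D2 (D2 x) r = 0" "D1 (D1 \<tau>) r + D2 (D2 \<tau>) r = 0"
      "D1 (D1 \<phi>) r + D2 (D2 \<phi>) r = 0"
      using harm r(1) by simp_all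
    \<comment> \<open>The antisymmetric part of the Hessian of \<open>u\<close> pulls back with factor \<open>det J\<close>, and the Hessians
      of \<open>x\<close>, \<open>\<tau>\<close> and \<open>\<phi>\<close> are symmetric.\<close>
    have "(b - b') * (D1 x r * D2 \<tau> r - D2 x r * D1 \<tau> r)
        = (D2 (D1 \<phi>) r - P * D2 (D1 x) r - Q * D2 (D1 \<tau>) r)
        - (D1 (D2 \<phi>) r - P * D1 (D2 x) r - Q * D1 (D2 \<tau>) r)"
      unfolding D1_def D2_def second by (simp add: algebra_simps)
    also have "\<dots> = 0"
      by (simp add: sy)
    finally have "(b - b') * (D1 x r * D2 \<tau> r - D2 x r * D1 \<tau> r) = 0" .
    then have "b' = b" using det by simp
    \<comment> \<open>The Laplacian of \<open>\<phi> = u(x, \<tau>)\<close>, without its first-order terms.\<close>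
    have "a * ((D1 x r)\<^sup>2 + (D2 x r)\<^sup>2) + 2 * b * (D1 x r * D1 \<tau> r + D2 x r * D2 \<tau> r)
        + c * ((D1 \<tau> r)\<^sup>2 + (D2 \<tau> r)\<^sup>2)
        = (D1 (D1 \<phi>) r + D2 (D2 \<phi>) r) - P * (D1 (D1 x) r + D2 (D2 x) r)
        - Q * (D1 (D1 \<tau>) r + D2 (D2 \<tau>) r)"
      unfolding D1_def D2_def second \<open>b' = b\<close> by (simp add: algebra_simps power2_eq_square)
    also have "\<dots> = 0"
      by (simp add: ha)
    finally have trace: "a * ((D1 x r)\<^sup>2 + (D2 x r)\<^sup>2)
        + 2 * b * (D1 x r * D1 \<tau> r + D2 x r * D2 \<tau> r)
        + c * ((D1 \<tau> r)\<^sup>2 + (D2 \<tau> r)\<^sup>2) = 0" .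
    show "(1 + (dir_deriv (0, 1) u p)\<^sup>2) * dir_deriv (1, 0) (dir_deriv (1, 0) u) p
      - 2 * dir_deriv (1, 0) u p * dir_deriv (0, 1) u p * dir_deriv (0, 1) (dir_deriv (1, 0) u) p
      + (1 + (dir_deriv (1, 0) u p)\<^sup>2) * dir_deriv (0, 1) (dir_deriv (0, 1) u) p = 0"
      unfolding P_def[symmetric] Q_def[symmetric] a_def[symmetric] b_def[symmetric] c_def[symmetric]
      by (rule conformal_graph_elimination[OF det _ _ trace, of P Q])
        (use conf[OF r(1)] orth[OF r(1)] in \<open>simp_all only: first\<close>)
  qed
  then show ?thesis by (simp add: u_def F_def)
qed

section \<open>The associate family\<close>

theorem proposition2p1:
  fixes U :: "complex set" and X Y :: "complex \<Rightarrow> real^3" and \<theta> :: real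
  assumes "open U"
    and "isothermal_minimal_surface U X"
    and "isothermal_minimal_surface U Y"
    and "harmonic_conjugates U X Y"
  shows "complex_born_infeld_soliton U
           (\<lambda>r. cos \<theta> *\<^sub>R imag_time (X r) + sin \<theta> *\<^sub>R imag_time (Y r))"
proof -
  define Z where "Z = (\<lambda>r. cos \<theta> *\<^sub>R X r + sin \<theta> *\<^sub>R Y r)"
  \<comment> \<open>The conjugate of \<open>Z\<close>: \<open>Z + \<i> Z' = exp (- \<i> \<theta>) (X + \<i> Y)\<close>.\<close>
  define Z' where "Z' = (\<lambda>r. cos \<theta> *\<^sub>R Y r + (- sin \<theta>) *\<^sub>R X r)"
  have smooth: "smooth_on U X" "smooth_on U Y"
    using assms(2,3) by (auto simp: isothermal_minimal_surface_def smooth_immersion_on_def)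
  have smZ: "smooth_on U Z" "smooth_on U Z'"
    unfolding Z_def Z'_def using assms(1) smooth by (simp_all only: smooth_on_linear_combination)
  have smZk: "smooth_on U (\<lambda>r. Z r $ k)" "smooth_on U (\<lambda>r. Z' r $ k)" for k
    by (intro smooth_on_bounded_linear[OF bounded_linear_vec_nth assms(1)] smZ)+
  have dX: "X differentiable (at r)" "Y differentiable (at r)" if "r \<in> U" for r
    using smooth_on_differentiable(1) smooth that by blast+
  have conj: "D2 Y r = D1 X r" "D1 Y r = - D2 X r" if "r \<in> U" for r
    using assms(4) that by (simp_all add: harmonic_conjugates_def)
  have DZ: "D1 Z r = cos \<theta> *\<^sub>R D1 X r - sin \<theta> *\<^sub>R D2 X r"
    "D2 Z r = cos \<theta> *\<^sub>R D2 X r + sin \<theta> *\<^sub>R D1 X r"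
    "D1 Z' r = - D2 Z r" "D2 Z' r = D1 Z r" if "r \<in> U" for r
    using conj[OF that]
    unfolding D1_def D2_def Z_def Z'_def
      dir_deriv_linear_combination[OF dX(1)[OF that] dX(2)[OF that]]
      dir_deriv_linear_combination[OF dX(2)[OF that] dX(1)[OF that]]
    by simp_all
  have comp: "dir_deriv v (\<lambda>r. f r $ k) r = dir_deriv v f r $ k"
    if "smooth_on U f" "r \<in> U" for f :: "complex \<Rightarrow> real^3" and v r k
    by (rule dir_deriv_bounded_linear[OF bounded_linear_vec_nth smooth_on_differentiable(1)[OF that]])
  have DZk: "D1 (\<lambda>r. Z r $ k) r = D1 Z r $ k" "D2 (\<lambda>r. Z r $ k) r = D2 Z r $ k"
    "D1 (\<lambda>r. Z' r $ k) r = D1 Z' r $ k" "D2 (\<lambda>r. Z' r $ k) r = D2 Z' r $ k" if "r \<in> U" for r k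
    using comp smZ that by (simp_all add: D1_def D2_def)
  have harm: "D1 (D1 (\<lambda>r. Z r $ k)) r + D2 (D2 (\<lambda>r. Z r $ k)) r = 0"
    "D1 (D2 (\<lambda>r. Z r $ k)) r = D2 (D1 (\<lambda>r. Z r $ k)) r" if "r \<in> U" for k r
    using conjugate_pair_harmonic[OF assms(1), of "\<lambda>r. Z r $ k" "\<lambda>r. Z' r $ k" r]
      smooth_on_differentiable(1)[OF smZk(1)] smooth_on_differentiable(1)[OF smZk(2)] DZ DZk that
    by simp_all
  have iso: "D1 X r \<bullet> D1 X r = D2 X r \<bullet> D2 X r" "D1 X r \<bullet> D2 X r = 0" if "r \<in> U" for r
    using assms(2) that by (auto simp: isothermal_minimal_surface_def)
  have conf: "D1 Z r \<bullet> D1 Z r = D2 Z r \<bullet> D2 Z r" "D1 Z r \<bullet> D2 Z r = 0" if "r \<in> U" for r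
    using iso[OF that] unfolding DZ[OF that]
    by (simp_all add: inner_diff_left inner_diff_right inner_add_left inner_add_right
        inner_commute algebra_simps)
  show ?thesis
    unfolding complex_born_infeld_soliton_def
  proof (intro exI conjI ballI allI impI)
    show "smooth_on U (\<lambda>r. Z r $ 1)" "smooth_on U (\<lambda>r. Z r $ 2)" "smooth_on U (\<lambda>r. Z r $ 3)"
      by (rule smZk(1))+
    show "cos \<theta> *\<^sub>R imag_time (X r) + sin \<theta> *\<^sub>R imag_time (Y r)
        = imag_time (vector [Z r $ 1, Z r $ 2, Z r $ 3])" for r
      by (simp add: imag_time_def Z_def vec_eq_iff forall_3 complex_eq_iff)
    fix V assume V: "V \<subseteq> U" "diffeo_onto_image V (\<lambda>r. (Z r $ 1, Z r $ 2))"
    show "imag_time_born_infeld_solution ((\<lambda>r. (Z r $ 1, Z r $ 2)) ` V)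
        (\<lambda>p. of_real (Z (inv_into V (\<lambda>r. (Z r $ 1, Z r $ 2)) p) $ 3))"
    proof (rule conformal_harmonic_graph[OF V(2), where \<phi> = "\<lambda>r. Z r $ 3"])
      show "smooth_on V (\<lambda>r. Z r $ 1)" "smooth_on V (\<lambda>r. Z r $ 2)" "smooth_on V (\<lambda>r. Z r $ 3)"
        using smooth_on_mono[OF smZk(1) V(1)] by blast+
    qed (use harm conf DZk V(1) in \<open>auto simp: inner_vec_def sum_3 power2_eq_square subset_iff\<close>)
  qed
qed

end
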